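(* Let $(X,T)$ be a topological dynamical system. Consider the following conditions: (1) $(X,T)$ is weakly mixing. (2) $Trans_{\mathcal F_{ip}}(X,T)$ is residual in $X$. (3) $(X,T)$ is $\mathcal F_{ip}$-point transitive. (4) $(X,T)$ is $\mathcal F_{Poin}$-transitive. Then (1)$\Rightarrow$(2)$\Rightarrow$(3)$\Rightarrow$(4). In addition, if $(X,T)$ is an E-system, then (4)$\Rightarrow$(1).
   Context: A topological dynamical system (TDS) is a pair $(X,T)$ with $X$ a nonempty compact metric space and $T:X\to X$ continuous. "Opene" means nonempty open. For opene $U,V\subset X$ and $x\in X$: $N(U,V)=\{n\in\mathbb Z_+: U\cap T^{-n}V\ne\emptyset\}$ and $N(x,U)=\{n\in\mathbb Z_+: T^nx\in U\}$, where $\mathbb Z_+$ is the set of non-negative integers and $\mathbb N$ the set of positive integers. $(X,T)$ is transitive if $N(U,V)$ is infinite for all opene $U,V$; it is weakly mixing if $(X\times X,T\times T)$ is transitive; it is an E-system if it is transitive and has a $T$-invariant Borel probability measure with full support. A family is a collection $\mathcal F$ of subsets of $\mathbb Z_+$ that is hereditary upward ($F_1\subset F_2$, $F_1\in\mathcal F$ imply $F_2\in\mathcal F$). $(X,T)$ is $\mathcal F$-transitive if $N(U,V)\in\mathcal F$ for all opene $U,V$. A point $x\in X$ is an $\mathcal F$-transitive point if $N(x,U)\in\mathcal F$ for every opene $U$; the set of these is $Trans_{\mathcal F}(X,T)$, and $(X,T)$ is $\mathcal F$-point transitive if this set is nonempty. $\mathcal F_{ip}$ is the family of IP sets: $F\subset\mathbb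 Z_+$ is an IP set if there is a sequence $\{p_i\}_{i=1}^\infty$ in $\mathbb N$ such that $F$ contains all sums $\sum_{i\in\alpha}p_i$, $\alpha$ a nonempty finite subset of $\mathbb N$. $\mathcal F_{Poin}$ is the family of Poincaré sequences: $F\subset\mathbb Z_+$ is a Poincaré sequence if for every measure-preserving system $(Y,\mathcal B,\mu,S)$ (probability space) and $A\in\mathcal B$ with $\mu(A)>0$ there is $0\neq n\in F$ with $\mu(A\cap S^{-n}A)>0$. A set is residual if it contains a dense $G_\delta$ subset. *)

theory Defs
  imports "HOL-Probability.Probability"
begin

text \<open>
  The phase space \<open>X\<close> of a system is the universe of a type of class \<open>metric_space\<close>, required to be
  compact; nonemptiness is automatic, since every type is inhabited.
\<close>

definition tds :: "('a::metric_space \<Rightarrow> 'a) \<Rightarrow> bool" where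
  "tds T \<longleftrightarrow> compact (UNIV :: 'a set) \<and> continuous_on UNIV T"

definition opene :: "'a::topological_space set \<Rightarrow> bool" where
  "opene U \<longleftrightarrow> open U \<and> U \<noteq> {}"

definition hitting_times :: "('a \<Rightarrow> 'a) \<Rightarrow> 'a set \<Rightarrow> 'a set \<Rightarrow> nat set" where
  "hitting_times T U V = {n. U \<inter> (T ^^ n) -` V \<noteq> {}}"

definition visiting_times :: "('a \<Rightarrow> 'a) \<Rightarrow> 'a \<Rightarrow> 'a set \<Rightarrow> nat set" where
  "visiting_times T x U = {n. (T ^^ n) x \<in> U}"

definition top_transitive :: "('a::topological_space \<Rightarrow> 'a) \<Rightarrow> bool" where
  "top_transitive T \<longleftrightarrow> (\<forall>U V. opene U \<longrightarrow> opene V \<longrightarrow> infinite (hitting_times T U V))"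

definition weakly_mixing :: "('a::topological_space \<Rightarrow> 'a) \<Rightarrow> bool" where
  "weakly_mixing T \<longleftrightarrow> top_transitive (map_prod T T)"

definition measure_preserving_system :: "'y measure \<Rightarrow> ('y \<Rightarrow> 'y) \<Rightarrow> bool" where
  "measure_preserving_system M S \<longleftrightarrow>
     prob_space M \<and> S \<in> M \<rightarrow>\<^sub>M M \<and>
     (\<forall>A\<in>sets M. emeasure M (S -` A \<inter> space M) = emeasure M A)"

definition E_system :: "('a::topological_space \<Rightarrow> 'a) \<Rightarrow> bool" where
  "E_system T \<longleftrightarrow> top_transitive T \<and>
     (\<exists>M :: 'a measure. sets M = sets borel \<and> measure_preserving_system M T \<and>
        (\<forall>U. opene U \<longrightarrow> emeasure M U > 0))"

definition F_transitive :: "nat set set \<Rightarrow> ('a::topological_space \<Rightarrow> 'a) \<Rightarrow> bool" where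
  "F_transitive \<F> T \<longleftrightarrow> (\<forall>U V. opene U \<longrightarrow> opene V \<longrightarrow> hitting_times T U V \<in> \<F>)"

definition Trans :: "nat set set \<Rightarrow> ('a::topological_space \<Rightarrow> 'a) \<Rightarrow> 'a set" where
  "Trans \<F> T = {x. \<forall>U. opene U \<longrightarrow> visiting_times T x U \<in> \<F>}"

definition F_point_transitive :: "nat set set \<Rightarrow> ('a::topological_space \<Rightarrow> 'a) \<Rightarrow> bool" where
  "F_point_transitive \<F> T \<longleftrightarrow> Trans \<F> T \<noteq> {}"

definition residual :: "'a::topological_space set \<Rightarrow> bool" where
  "residual A \<longleftrightarrow> (\<exists>D. gdelta_in euclidean D \<and> closure D = UNIV \<and> D \<subseteq> A)"

definition family :: "nat set set \<Rightarrow> bool" where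
  "family \<F> \<longleftrightarrow> (\<forall>F1 F2. F1 \<subseteq> F2 \<longrightarrow> F1 \<in> \<F> \<longrightarrow> F2 \<in> \<F>)"

definition F_ip :: "nat set set" where
  "F_ip = {F. \<exists>p :: nat \<Rightarrow> nat. (\<forall>i. p i > 0) \<and>
              (\<forall>\<alpha>. finite \<alpha> \<longrightarrow> \<alpha> \<noteq> {} \<longrightarrow> (\<Sum>i\<in>\<alpha>. p i) \<in> F)}"

definition recurrent_along :: "nat set \<Rightarrow> 'y measure \<Rightarrow> ('y \<Rightarrow> 'y) \<Rightarrow> bool" where
  "recurrent_along F M S \<longleftrightarrow>
     (\<forall>A\<in>sets M. emeasure M A > 0 \<longrightarrow>
        (\<exists>n\<in>F. n \<noteq> 0 \<and> emeasure M (A \<inter> (S ^^ n) -` A) > 0))"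

text \<open>
  A definition cannot quantify over all types, so the measure-preserving systems below live on
  subsets of one type, with arbitrary \<open>\<sigma>\<close>-algebra, measure and transformation.
  Nothing is lost: the theorem \<open>F_Poin_recurrent\<close> below shows that the members of \<open>F_Poin\<close> are sets
  of recurrence for the measure-preserving systems on every type (code points by their itinerary
  with respect to the given set).
\<close>

definition F_Poin :: "nat set set" where
  "F_Poin = {F. \<forall>(M :: (nat \<Rightarrow> bool) measure) S.
                  measure_preserving_system M S \<longrightarrow> recurrent_along F M S}"

lemma family_F_ip: "family F_ip"
  unfolding family_def F_ip_def by blast

lemma family_F_Poin: "family F_Poin"
  unfolding family_def F_Poin_def recurrent_along_def by blast

theorem F_Poin_recurrent:
  fixes M :: "'y measure"
  assumes F: "F \<in> F_Poin" and mps: "measure_preserving_system M S"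
  shows "recurrent_along F M S"
  unfolding recurrent_along_def
proof (intro ballI impI)
  fix A assume A: "A \<in> sets M" and pos: "emeasure M A > 0"
  interpret prob_space M using mps by (simp add: measure_preserving_system_def)
  have S[measurable]: "S \<in> M \<rightarrow>\<^sub>M M" and
    inv: "\<And>B. B \<in> sets M \<Longrightarrow> emeasure M (S -` B \<inter> space M) = emeasure M B"
    using mps by (auto simp: measure_preserving_system_def)
  have Sn[measurable]: "S ^^ n \<in> M \<rightarrow>\<^sub>M M" for n
    by (rule measurable_compose_n) (rule S)
  define P where "P = (\<Pi>\<^sub>M i\<in>(UNIV::nat set). count_space (UNIV::bool set))"
  define c where "c = (\<lambda>y (n::nat). (S ^^ n) y \<in> A)"
  define shift where "shift = (\<lambda>(w::nat \<Rightarrow> bool) n. w (Suc n))"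
  define N where "N = distr M P c"
  have spP: "space P = UNIV" by (auto simp: P_def space_PiM)
  have c[measurable]: "c \<in> M \<rightarrow>\<^sub>M P"
    unfolding c_def P_def using A by (intro measurable_PiM_single') auto
  have sh[measurable]: "shift \<in> P \<rightarrow>\<^sub>M P"
    unfolding shift_def P_def
    by (intro measurable_PiM_single') (auto intro!: measurable_component_singleton)
  have comm: "shift (c y) = c (S y)" for y
    unfolding shift_def c_def by (simp add: funpow_swap1)
  have commn: "(shift ^^ n) w = (\<lambda>k. w (k + n))" for n w
    by (induction n arbitrary: w) (auto simp: shift_def)
  have "measure_preserving_system N shift"
    unfolding measure_preserving_system_def
  proof (intro conjI ballI)
    show "prob_space N" unfolding N_def by (rule prob_space_distr) (rule c)
    show "shift \<in> N \<rightarrow>\<^sub>M N" unfolding N_def by simp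
    fix B assume "B \<in> sets N"
    then have B[measurable]: "B \<in> sets P" by (simp add: N_def)
    have "emeasure N (shift -` B \<inter> space N) = emeasure M (c -` (shift -` B \<inter> space P) \<inter> space M)"
      unfolding N_def by (subst emeasure_distr) auto
    also have "c -` (shift -` B \<inter> space P) \<inter> space M = S -` (c -` B \<inter> space M) \<inter> space M"
      using measurable_space[OF S] by (auto simp: spP comm)
    also have "emeasure M \<dots> = emeasure M (c -` B \<inter> space M)"
      by (rule inv) measurable
    also have "\<dots> = emeasure N B"
      unfolding N_def by (subst emeasure_distr) auto
    finally show "emeasure N (shift -` B \<inter> space N) = emeasure N B" .
  qed
  then have rec: "recurrent_along F N shift"
    using F by (simp add: F_Poin_def)
  define C where "C = {w :: nat \<Rightarrow> bool. w 0}"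
  have evP: "{w. w k} \<in> sets P" for k :: nat
  proof -
    have "(\<lambda>w. w k) -` {True} \<inter> space P \<in> sets P"
      unfolding P_def by (intro measurable_sets[OF measurable_component_singleton]) auto
    then show ?thesis by (simp add: spP vimage_def)
  qed
  have CN: "C \<in> sets N" using evP[of 0] by (simp add: N_def C_def)
  have Asub: "A \<subseteq> space M" using A by (rule sets.sets_into_space)
  have "emeasure N C = emeasure M (c -` C \<inter> space M)"
    unfolding N_def using CN by (subst emeasure_distr) (auto simp: N_def)
  also have "c -` C \<inter> space M = A" using Asub by (auto simp: C_def c_def)
  finally have "emeasure N C > 0" using pos by simp
  with rec CN obtain n where n: "n \<in> F" "n \<noteq> 0" "emeasure N (C \<inter> (shift ^^ n) -` C) > 0"
    unfolding recurrent_along_def by blast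
  have eq: "C \<inter> (shift ^^ n) -` C = {w. w 0} \<inter> {w. w n}"
    by (auto simp: C_def commn)
  have "emeasure N (C \<inter> (shift ^^ n) -` C) = emeasure M (c -` ({w. w 0} \<inter> {w. w n}) \<inter> space M)"
    unfolding eq unfolding N_def using evP by (subst emeasure_distr) auto
  also have "c -` ({w. w 0} \<inter> {w. w n}) \<inter> space M = A \<inter> (S ^^ n) -` A"
    using Asub by (auto simp: c_def)
  finally show "\<exists>n\<in>F. n \<noteq> 0 \<and> emeasure M (A \<inter> (S ^^ n) -` A) > 0"
    using n by auto
qed

end

theory Submission
  imports Defs
begin

text \<open>
  For (1) to (2): a point \<open>x\<close> is an \<open>F_ip\<close>-transitive point as soon as, for every nonempty
  member \<open>W\<close> of a countable base, some \<open>n > 0\<close> lies both in \<open>N(x, W)\<close> and in \<open>N(W, W)\<close>; the sums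
  are then built by repeatedly shrinking \<open>W\<close> to a base set inside \<open>W \<inter> T\<^sup>-\<^sup>n W\<close>. Weak mixing makes
  each of these countably many conditions open and dense, and Baire's theorem applies.

  For (3) to (4): if \<open>N(x, U)\<close> and \<open>N(x, V)\<close> contain the finite sums of \<open>p\<close> and \<open>q\<close>, then \<open>N(U, V)\<close>
  contains all differences \<open>s\<^sub>j - s\<^sub>i\<close>, \<open>i < j\<close>, where \<open>s\<^sub>k\<close> is a partial sum of \<open>q\<close> minus the \<open>k\<close>-th
  partial sum of \<open>p\<close>. Such difference sets are Poincare sequences by the pigeonhole principle.

  For (4) to (1): the invariant measure of full support gives \<open>N(U, U) \<inter> N(U, V) \<noteq> {}\<close> for all opene
  \<open>U, V\<close>, and two successive shrinkings upgrade this to weak mixing.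
\<close>

subsection \<open>Poincare sequences\<close>

lemma measure_preserving_funpow:
  assumes "measure_preserving_system M S" and "B \<in> sets M"
  shows "(S ^^ n) -` B \<inter> space M \<in> sets M"
    and "emeasure M ((S ^^ n) -` B \<inter> space M) = emeasure M B"
proof -
  have S[measurable]: "S \<in> M \<rightarrow>\<^sub>M M"
    and inv: "\<And>B. B \<in> sets M \<Longrightarrow> emeasure M (S -` B \<inter> space M) = emeasure M B"
    using assms(1) by (auto simp: measure_preserving_system_def)
  have Sn[measurable]: "S ^^ n \<in> M \<rightarrow>\<^sub>M M" for n
    by (rule measurable_compose_n) (rule S)
  show sets: "(S ^^ n) -` B \<inter> space M \<in> sets M" for n
    using Sn assms(2) by (rule measurable_sets)
  show "emeasure M ((S ^^ n) -` B \<inter> space M) = emeasure M B"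
  proof (induction n)
    case 0
    show ?case using sets.sets_into_space[OF assms(2)] by (simp add: Int_absorb2)
  next
    case (Suc n)
    have "(S ^^ Suc n) -` B \<inter> space M = S -` ((S ^^ n) -` B \<inter> space M) \<inter> space M"
      using measurable_space[OF S] by (auto simp: funpow_swap1)
    then have "emeasure M ((S ^^ Suc n) -` B \<inter> space M) = emeasure M ((S ^^ n) -` B \<inter> space M)"
      using inv[OF sets, of n] by (rule trans[OF arg_cong])
    then show ?case using Suc.IH by (rule trans)
  qed
qed

text \<open>If no element of \<open>F\<close> served \<open>A\<close>, the preimages of
  \<open>A\<close> under the maps \<open>S ^^ s i\<close> would be pairwise disjoint up to null
  sets. They all have the measure of \<open>A\<close>, so finitely many of them would exceed total
  mass 1.\<close>

lemma recurrent_along_differences: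
  fixes s :: "nat \<Rightarrow> nat"
  assumes mps: "measure_preserving_system M S" and s: "strict_mono s"
    and F: "\<And>i j. i < j \<Longrightarrow> s j - s i \<in> F"
  shows "recurrent_along F M S"
  unfolding recurrent_along_def
proof (intro ballI impI, rule ccontr)
  fix A
  assume A: "A \<in> sets M" and pos: "emeasure M A > 0"
    and no: "\<not> (\<exists>n\<in>F. n \<noteq> 0 \<and> emeasure M (A \<inter> (S ^^ n) -` A) > 0)"
  interpret prob_space M using mps by (simp add: measure_preserving_system_def)
  define B where "B i = (S ^^ s i) -` A \<inter> space M" for i
  have B: "B i \<in> sets M" and mB: "measure M (B i) = measure M A" for i
    using measure_preserving_funpow[OF mps A] by (auto simp: B_def measure_def)
  have null: "B i \<inter> B j \<in> null_sets M" if "i < j" for i j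
  proof -
    define n where "n = s j - s i"
    have n: "s j = n + s i" "n \<noteq> 0"
      using strict_monoD[OF s that] by (auto simp: n_def)
    have eq: "A \<inter> (S ^^ n) -` A = A \<inter> ((S ^^ n) -` A \<inter> space M)"
      using sets.sets_into_space[OF A] by auto
    have sets: "A \<inter> (S ^^ n) -` A \<in> sets M"
      unfolding eq using A measure_preserving_funpow(1)[OF mps A] by auto
    have "emeasure M (A \<inter> (S ^^ n) -` A) = 0"
      using no F[OF that, folded n_def] n(2) by (auto simp: not_less)
    \<comment> \<open>Since \<open>s j = n + s i\<close>, the overlap is itself a preimage under
      \<open>S ^^ s i\<close>, so its measure is that of \<open>A\<close> intersected with its
      preimage under \<open>S ^^ n\<close>, which is 0.\<close>
    moreover have "B i \<inter> B j = (S ^^ s i) -` (A \<inter> (S ^^ n) -` A) \<inter> space M"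
      by (auto simp: B_def n(1) funpow_add)
    ultimately show ?thesis
      using measure_preserving_funpow[OF mps sets] by (simp add: null_sets_def)
  qed
  have pw: "pairwise (\<lambda>i j. AE x in M. x \<notin> B i \<or> x \<notin> B j) I" for I
    unfolding pairwise_def
  proof (intro ballI impI)
    fix i j :: nat assume "i \<noteq> j"
    then have "B i \<inter> B j \<in> null_sets M"
      using null[of i j] null[of j i] by (auto simp: Int_commute neq_iff)
    from AE_not_in[OF this] show "AE x in M. x \<notin> B i \<or> x \<notin> B j" by simp
  qed
  have "measure M A > 0"
    using pos by (simp add: emeasure_eq_measure)
  then obtain N :: nat where N: "1 < real N * measure M A"
    using reals_Archimedean3 by blast
  have "measure M (\<Union>i<N. B i) = (\<Sum>i<N. measure M (B i))"
    using B by (intro measure_UNION_AE pw) (auto simp: fmeasurable_eq_sets)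
  then have "measure M (\<Union>i<N. B i) > 1"
    using N by (simp add: mB)
  then show False using prob_le_1[of "\<Union>i<N. B i"] by linarith
qed

lemma F_Poin_differences:
  fixes s :: "nat \<Rightarrow> nat"
  assumes "strict_mono s" "\<And>i j. i < j \<Longrightarrow> s j - s i \<in> F"
  shows "F \<in> F_Poin"
  unfolding F_Poin_def
proof (intro CollectI allI impI)
  fix M :: "(nat \<Rightarrow> bool) measure" and S
  assume "measure_preserving_system M S"
  then show "recurrent_along F M S" using assms by (rule recurrent_along_differences)
qed

text \<open>A difference of two partial sums is a sum over a block of consecutive indices. So
  \<open>s j - s i\<close> is a block sum of \<open>q\<close>, lying in \<open>Q\<close>, minus a
  block sum of \<open>p\<close>, lying in \<open>P\<close>.\<close>

lemma F_ip_differences_F_Poin: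
  assumes P: "P \<in> F_ip" and Q: "Q \<in> F_ip"
  shows "{n. \<exists>i\<in>P. i + n \<in> Q} \<in> F_Poin"
proof -
  obtain p :: "nat \<Rightarrow> nat" where
      p: "\<And>\<alpha>. finite \<alpha> \<Longrightarrow> \<alpha> \<noteq> {} \<Longrightarrow> (\<Sum>i\<in>\<alpha>. p i) \<in> P"
    using P unfolding F_ip_def by blast
  obtain q :: "nat \<Rightarrow> nat" where qpos: "\<And>i. q i > 0"
    and q: "\<And>\<alpha>. finite \<alpha> \<Longrightarrow> \<alpha> \<noteq> {} \<Longrightarrow> (\<Sum>i\<in>\<alpha>. q i) \<in> Q"
    using Q unfolding F_ip_def by blast
  txt \<open>Between the indices \<open>c k\<close> and \<open>c (k + 1)\<close> there are \<open>p k + 1\<close> positive terms of \<open>q\<close>, whose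
    sum therefore exceeds \<open>p k\<close>; this makes \<open>s\<close> strictly increasing and the subtraction exact.\<close>
  define c where "c k = (\<Sum>i<k. p i) + k" for k
  define s where "s k = (\<Sum>i<c k. q i) - (\<Sum>i<k. p i)" for k
  have card: "card \<alpha> \<le> (\<Sum>i\<in>\<alpha>. q i)" for \<alpha>
    using sum_mono[of \<alpha> "\<lambda>_. 1" q] qpos by (simp add: Suc_le_eq)
  have le: "(\<Sum>i<k. p i) \<le> (\<Sum>i<c k. q i)" for k
    using card[of "{..<c k}"] by (simp add: c_def)
  have split: "(\<Sum>i<n. f i) = (\<Sum>i<m. f i) + (\<Sum>i=m..<n. f i)" if "m \<le> n" for m n and f :: "nat \<Rightarrow> nat"
    using that sum.atLeastLessThan_concat[of 0 m n f] by (simp add: atLeast0LessThan)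
  have c_less: "c i < c j" if "i < j" for i j
    using that split[of i j p] by (simp add: c_def)
  have gap: "(\<Sum>k=i..<j. p k) < (\<Sum>k=c i..<c j. q k)" if "i < j" for i j
    using card[of "{c i..<c j}"] split[of i j p] that by (simp add: c_def)
  \<comment> \<open>Stated additively, because subtraction on \<open>nat\<close> truncates;
    \<open>le\<close> ensures that no truncation occurs in \<open>s\<close>.\<close>
  have s_eq: "s j + (\<Sum>k=i..<j. p k) = s i + (\<Sum>k=c i..<c j. q k)" if "i < j" for i j
    using le[of i] le[of j] split[of i j p] split[of "c i" "c j" q] c_less[OF that] that
    by (simp add: s_def)
  have mono: "s i < s j" if "i < j" for i j
    using s_eq[OF that] gap[OF that] by linarith
  show ?thesis
  proof (rule F_Poin_differences)
    show "strict_mono s" using mono by (rule strict_monoI)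
    fix i j :: nat assume "i < j"
    then have "(\<Sum>k=i..<j. p k) \<in> P" "(\<Sum>k=c i..<c j. q k) \<in> Q"
      using c_less by (auto intro!: p q)
    moreover have "(\<Sum>k=i..<j. p k) + (s j - s i) = (\<Sum>k=c i..<c j. q k)"
      using s_eq[OF \<open>i < j\<close>] mono[OF \<open>i < j\<close>] by linarith
    ultimately show "s j - s i \<in> {n. \<exists>i\<in>P. i + n \<in> Q}"
      by (intro CollectI bexI[of _ "\<Sum>k=i..<j. p k"]) simp_all
  qed
qed

text \<open>If the orbit of \<open>x\<close> is in \<open>U\<close> at time \<open>i\<close> and in
  \<open>V\<close> at time \<open>i + n\<close>, then \<open>(T ^^ i) x\<close> witnesses that
  \<open>n\<close> is a hitting time from \<open>U\<close> to \<open>V\<close>.\<close>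

lemma F_point_transitive_ip_imp_F_transitive_Poin:
  fixes T :: "'a::topological_space \<Rightarrow> 'a"
  assumes "F_point_transitive F_ip T"
  shows "F_transitive F_Poin T"
  unfolding F_transitive_def
proof (intro allI impI)
  fix U V :: "'a set" assume "opene U" "opene V"
  with assms obtain x where "visiting_times T x U \<in> F_ip" "visiting_times T x V \<in> F_ip"
    unfolding F_point_transitive_def Trans_def by blast
  then have "{n. \<exists>i\<in>visiting_times T x U. i + n \<in> visiting_times T x V} \<in> F_Poin"
    by (rule F_ip_differences_F_Poin)
  moreover have "{n. \<exists>i\<in>visiting_times T x U. i + n \<in> visiting_times T x V} \<subseteq> hitting_times T U V"
  proof clarify
    fix n i assume "i \<in> visiting_times T x U" "i + n \<in> visiting_times T x V"
    then have "(T ^^ i) x \<in> U \<inter> (T ^^ n) -` V"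
      using funpow_add[of n i T] by (simp add: visiting_times_def add.commute)
    then show "n \<in> hitting_times T U V" by (auto simp only: hitting_times_def)
  qed
  ultimately show "hitting_times T U V \<in> F_Poin"
    using family_F_Poin unfolding family_def by blast
qed

subsection \<open>From weak mixing to points with IP return times\<close>

lemma continuous_on_funpow:
  fixes T :: "'a::topological_space \<Rightarrow> 'a"
  assumes "continuous_on UNIV T"
  shows "continuous_on UNIV (T ^^ n)"
proof (induction n)
  case (Suc n)
  show ?case
    using continuous_on_compose[OF Suc continuous_on_subset[OF assms]] by (simp add: o_def)
qed (simp add: id_def)

lemma open_funpow_vimage:
  fixes T :: "'a::topological_space \<Rightarrow> 'a"
  assumes "continuous_on UNIV T" "open U"
  shows "open ((T ^^ n) -` U)"
  using continuous_on_funpow[OF assms(1)] assms(2) by (simp add: continuous_on_open_vimage)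

text \<open>Total boundedness supplies a finite net for each radius \<open>1 / Suc n\<close>; the
  balls around all these nets form the base.\<close>

lemma compact_UNIV_countable_base:
  assumes "compact (UNIV :: 'a::metric_space set)"
  obtains \<B> :: "'a::metric_space set set"
  where "countable \<B>" "\<And>B. B \<in> \<B> \<Longrightarrow> opene B"
    "\<And>U x. open U \<Longrightarrow> x \<in> U \<Longrightarrow> \<exists>B\<in>\<B>. x \<in> B \<and> B \<subseteq> U"
proof -
  have "\<forall>n. \<exists>k :: 'a set. finite k \<and> UNIV \<subseteq> (\<Union>x\<in>k. ball x (1 / real (Suc n)))"
    using seq_compact_imp_totally_bounded[OF compact_imp_seq_compact[OF assms]]
    by (meson of_nat_0_less_iff zero_less_Suc zero_less_divide_1_iff)
  then obtain K :: "nat \<Rightarrow> 'a set"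
    where K: "\<And>n. finite (K n)" "\<And>n. UNIV \<subseteq> (\<Union>x\<in>K n. ball x (1 / real (Suc n)))"
    by metis
  define \<B> where "\<B> = (\<Union>n. (\<lambda>x. ball x (1 / real (Suc n))) ` K n)"
  show thesis
  proof
    show "countable \<B>"
      unfolding \<B>_def by (rule countable_UN) (simp_all add: countable_finite K(1))
    show "opene B" if "B \<in> \<B>" for B
      using that by (auto simp: \<B>_def opene_def)
    fix U :: "'a set" and x assume "open U" "x \<in> U"
    then obtain e where e: "e > 0" "ball x e \<subseteq> U"
      by (auto simp: open_contains_ball)
    obtain n where n: "1 / real (Suc n) < e / 2"
      using nat_approx_posE[of "e / 2"] e(1) by auto
    obtain y where y: "y \<in> K n" "x \<in> ball y (1 / real (Suc n))"
      using K(2)[of n] by blast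
    have "ball y (1 / real (Suc n)) \<subseteq> ball x e"
    proof
      fix z assume "z \<in> ball y (1 / real (Suc n))"
      then have "dist x z < 1 / real (Suc n) + 1 / real (Suc n)"
        using y(2) dist_triangle[of x z y] by (simp add: dist_commute)
      then show "z \<in> ball x e" using n by (simp add: dist_commute)
    qed
    with e(2) y show "\<exists>B\<in>\<B>. x \<in> B \<and> B \<subseteq> U"
      by (intro bexI[of _ "ball y (1 / real (Suc n))"]) (auto simp: \<B>_def)
  qed
qed

text \<open>The terms of a finite sum are applied from the largest index down: a point already in
  \<open>W (Suc k)\<close> is carried into \<open>W k\<close> by \<open>T ^^ p k\<close>.\<close>

lemma visiting_times_F_ipI:
  assumes W: "\<And>k. W (Suc k) \<subseteq> W k \<inter> (T ^^ p k) -` W k"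
    and p: "\<And>k. p k > 0" and x: "\<And>k. (T ^^ p k) x \<in> W k"
  shows "visiting_times T x (W 0) \<in> F_ip"
proof -
  have anti: "W k \<subseteq> W j" if "j \<le> k" for j k
    using W by (intro lift_Suc_antimono_le[OF _ that]) blast
  \<comment> \<open>The target \<open>W (Min \<alpha>)\<close>, sharper than \<open>W 0\<close>,
    makes the induction work: each step inserts an index \<open>k\<close> below all earlier ones, so
    the old point lies in \<open>W (Suc k)\<close>.\<close>
  have *: "(T ^^ (\<Sum>i\<in>\<alpha>. p i)) x \<in> W (Min \<alpha>)" if "finite \<alpha>" "\<alpha> \<noteq> {}" for \<alpha>
    using that
  proof (induction \<alpha> rule: finite_linorder_min_induct)
    case (insert k \<beta>)
    show ?case
    proof (cases "\<beta> = {}")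
      case True
      then show ?thesis using x by simp
    next
      case False
      with insert have "(T ^^ (\<Sum>i\<in>\<beta>. p i)) x \<in> W (Suc k)"
        using anti[of "Suc k" "Min \<beta>"] by (auto simp: Suc_le_eq)
      then have "(T ^^ p k) ((T ^^ (\<Sum>i\<in>\<beta>. p i)) x) \<in> W k"
        using W by blast
      moreover have "Min (insert k \<beta>) = k"
        using insert by (intro Min_eqI) auto
      moreover have "(\<Sum>i\<in>insert k \<beta>. p i) = p k + (\<Sum>i\<in>\<beta>. p i)"
        using insert by (intro sum.insert) auto
      ultimately show ?thesis by (simp add: funpow_add)
    qed
  qed simp
  show ?thesis
    unfolding F_ip_def
  proof (intro CollectI exI[of _ p] conjI allI impI)
    fix \<alpha> :: "nat set" assume "finite \<alpha>" "\<alpha> \<noteq> {}"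
    then show "(\<Sum>i\<in>\<alpha>. p i) \<in> visiting_times T x (W 0)"
      using * anti[of 0 "Min \<alpha>"] by (auto simp: visiting_times_def)
  qed (rule p)
qed

lemma Trans_F_ipI:
  fixes T :: "'a::topological_space \<Rightarrow> 'a"
  assumes cont: "continuous_on UNIV T"
    and opene: "\<And>B. B \<in> \<B> \<Longrightarrow> opene B"
    and base: "\<And>U x. open U \<Longrightarrow> x \<in> U \<Longrightarrow> \<exists>B\<in>\<B>. x \<in> B \<and> B \<subseteq> U"
    and x: "\<And>B. B \<in> \<B> \<Longrightarrow> \<exists>n>0. n \<in> hitting_times T B B \<and> n \<in> visiting_times T x B"
  shows "x \<in> Trans F_ip T"
  unfolding Trans_def
proof (intro CollectI allI impI)
  fix U :: "'a set" assume U: "opene U"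
  \<comment> \<open>One time with two uses: being in \<open>hitting_times T B B\<close> it makes the
    next, smaller base set possible, and being in \<open>visiting_times T x B\<close> it brings
    \<open>x\<close> into \<open>B\<close>.\<close>
  define r where "r B = (SOME n. n > 0 \<and> n \<in> hitting_times T B B \<and> n \<in> visiting_times T x B)" for B
  have r: "r B > 0 \<and> r B \<in> hitting_times T B B \<and> r B \<in> visiting_times T x B" if "B \<in> \<B>" for B
    unfolding r_def using x[OF that] by (rule someI2_ex)
  have "\<exists>B'\<in>\<B>. B' \<subseteq> B \<inter> (T ^^ r B) -` B" if B: "B \<in> \<B>" for B
  proof -
    have "open (B \<inter> (T ^^ r B) -` B)"
      using opene[OF B] open_funpow_vimage[OF cont] by (auto simp: opene_def)
    moreover obtain y where "y \<in> B \<inter> (T ^^ r B) -` B"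
      using r[OF B] by (auto simp: hitting_times_def)
    ultimately show ?thesis using base by blast
  qed
  then obtain h where h: "\<And>B. B \<in> \<B> \<Longrightarrow> h B \<in> \<B> \<and> h B \<subseteq> B \<inter> (T ^^ r B) -` B"
    by metis
  obtain B0 where B0: "B0 \<in> \<B>" "B0 \<subseteq> U"
    using base U unfolding opene_def by blast
  define W where "W k = (h ^^ k) B0" for k
  have W: "W k \<in> \<B>" for k
    by (induction k) (auto simp: W_def B0 h)
  have "visiting_times T x (W 0) \<in> F_ip"
  proof (rule visiting_times_F_ipI[where p = "\<lambda>k. r (W k)"])
    show "W (Suc k) \<subseteq> W k \<inter> (T ^^ r (W k)) -` W k" for k
      using h[OF W[of k]] by (simp add: W_def)
    show "0 < r (W k)" and "(T ^^ r (W k)) x \<in> W k" for k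
      using r[OF W[of k]] by (auto simp: visiting_times_def)
  qed
  moreover have "visiting_times T x (W 0) \<subseteq> visiting_times T x U"
    using B0 by (auto simp: visiting_times_def W_def)
  ultimately show "visiting_times T x U \<in> F_ip"
    using family_F_ip unfolding family_def by blast
qed

lemma funpow_map_prod:
  fixes f :: "'a \<Rightarrow> 'a" and g :: "'b \<Rightarrow> 'b"
  shows "map_prod f g ^^ n = map_prod (f ^^ n) (g ^^ n)"
  by (induction n) (auto simp: fun_eq_iff)

lemma hitting_times_map_prod:
  "hitting_times (map_prod f g) (U1 \<times> U2) (V1 \<times> V2) = hitting_times f U1 V1 \<inter> hitting_times g U2 V2"
  by (auto simp: hitting_times_def funpow_map_prod)

lemma weakly_mixing_imp_residual:
  fixes T :: "'a::metric_space \<Rightarrow> 'a"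
  assumes comp: "compact (UNIV :: 'a set)" and cont: "continuous_on UNIV T" and wm: "weakly_mixing T"
  shows "residual (Trans F_ip T)"
proof -
  obtain \<B> :: "'a set set" where \<B>: "countable \<B>" "\<And>B. B \<in> \<B> \<Longrightarrow> opene B"
    "\<And>U x. open U \<Longrightarrow> x \<in> U \<Longrightarrow> \<exists>B\<in>\<B>. x \<in> B \<and> B \<subseteq> U"
    using compact_UNIV_countable_base[OF comp] by blast
  \<comment> \<open>The points satisfying the hypothesis of \<open>Trans_F_ipI\<close> for the base
    set \<open>B\<close>.\<close>
  define G where "G B = (\<Union>n\<in>{0<..} \<inter> hitting_times T B B. (T ^^ n) -` B)" for B
  have G_open: "open (G B)" if "B \<in> \<B>" for B
    using \<B>(2)[OF that] open_funpow_vimage[OF cont] by (auto simp: G_def opene_def)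
  have G_dense: "closure (G B) = UNIV" if "B \<in> \<B>" for B
  proof -
    have meets: "G B \<inter> V \<noteq> {}" if V: "open V" "V \<noteq> {}" for V
    proof -
      have "opene (V \<times> B)" "opene (B \<times> B)"
        using V \<B>(2)[OF \<open>B \<in> \<B>\<close>] by (auto simp: opene_def open_Times)
      \<comment> \<open>Transitivity of the product yields one time that both returns
        \<open>B\<close> to itself and takes a point of \<open>V\<close> into \<open>B\<close>; that
        point lies in \<open>G B\<close>.\<close>
      then have "infinite (hitting_times T V B \<inter> hitting_times T B B)"
        using wm unfolding weakly_mixing_def top_transitive_def hitting_times_map_prod[symmetric] by blast
      then obtain n where "n > 0" "n \<in> hitting_times T V B" "n \<in> hitting_times T B B"
        by (meson Int_iff infinite_nat_iff_unbounded)
      then show ?thesis by (auto simp: G_def hitting_times_def)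
    qed
    have "x \<in> closure (G B)" for x
      unfolding closure_iff_nhds_not_empty
    proof (intro allI impI)
      fix A V assume "V \<subseteq> A" "open V" "x \<in> V"
      then show "G B \<inter> A \<noteq> {}" using meets[of V] by blast
    qed
    then show ?thesis by blast
  qed
  have "\<B> \<noteq> {}" using \<B>(3)[of UNIV] by auto
  define D where "D = (\<Inter>B\<in>\<B>. G B)"
  have "gdelta_in euclidean D"
    unfolding D_def using \<B>(1) \<open>\<B> \<noteq> {}\<close> G_open
    by (intro gdelta_in_Inter) (auto intro!: open_imp_gdelta_in)
  moreover have "(euclidean :: 'a topology) closure_of \<Inter>(G ` \<B>) = topspace euclidean"
  proof (rule Baire_category)
    show "completely_metrizable_space (euclidean :: 'a topology) \<or>
      locally_compact_space (euclidean :: 'a topology) \<and> regular_space (euclidean :: 'a topology)"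
      using comp by (intro disjI2 conjI compact_imp_locally_compact_space
          metrizable_imp_regular_space metrizable_space_euclidean) (simp add: compact_space_def)
  qed (use \<B>(1) G_open G_dense in auto)
  then have "closure D = UNIV" by (simp add: D_def)
  moreover have "D \<subseteq> Trans F_ip T"
  proof
    fix x assume "x \<in> D"
    then have "\<exists>n>0. n \<in> hitting_times T B B \<and> n \<in> visiting_times T x B" if "B \<in> \<B>" for B
      using that by (auto simp: D_def G_def visiting_times_def)
    with cont \<B>(2,3) show "x \<in> Trans F_ip T" by (rule Trans_F_ipI)
  qed
  ultimately show ?thesis unfolding residual_def by blast
qed

subsection \<open>From measure recurrence to weak mixing\<close>

text \<open>Transitivity gives each iterate a dense image: a hitting time \<open>n > k\<close>
  exhibits a point of \<open>V\<close> as a value of \<open>T ^^ k\<close>.\<close>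

lemma top_transitive_opene_vimage:
  fixes T :: "'a::topological_space \<Rightarrow> 'a"
  assumes "continuous_on UNIV T" "top_transitive T" "opene V"
  shows "opene ((T ^^ k) -` V)"
proof -
  have "infinite (hitting_times T V V)"
    using assms by (auto simp: top_transitive_def)
  then obtain n where "n > k" "n \<in> hitting_times T V V"
    by (meson infinite_nat_iff_unbounded)
  then obtain x where "(T ^^ n) x \<in> V" by (auto simp: hitting_times_def)
  moreover have "(T ^^ n) x = (T ^^ k) ((T ^^ (n - k)) x)"
    using \<open>n > k\<close> funpow_add[of k "n - k" T] by simp
  ultimately have "(T ^^ k) -` V \<noteq> {}" by auto
  then show ?thesis
    using assms open_funpow_vimage by (auto simp: opene_def)
qed

lemma weakly_mixingI:
  fixes T :: "'a::topological_space \<Rightarrow> 'a"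
  assumes cont: "continuous_on UNIV T" and trans: "top_transitive T"
    and hit: "\<And>U V. opene U \<Longrightarrow> opene V \<Longrightarrow> hitting_times T U U \<inter> hitting_times T U V \<noteq> {}"
  shows "weakly_mixing T"
proof -
  note vim = top_transitive_opene_vimage[OF cont trans]
  have meet: "\<exists>m. opene (U \<inter> (T ^^ m) -` V)" if UV: "opene U" "opene V" for U V
  proof -
    obtain m where "m \<in> hitting_times T U V"
      using hit[OF UV] by blast
    with UV open_funpow_vimage[OF cont, of V m] show ?thesis
      by (auto simp: hitting_times_def opene_def)
  qed
  \<comment> \<open>Applying \<open>hit\<close> inside \<open>A\<close> cut down to points that
    reach \<open>V1\<close> after \<open>m\<close> steps, a return at time \<open>n\<close> gives a
    visit to \<open>V1\<close> at time \<open>m + n\<close>; pulling \<open>V2\<close> back by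
    \<open>m\<close> steps puts its visit at the same time.\<close>
  have one: "hitting_times T A V1 \<inter> hitting_times T A V2 \<noteq> {}"
    if "opene A" "opene V1" "opene V2" for A V1 V2
  proof -
    obtain m where C: "opene (A \<inter> (T ^^ m) -` V1)"
      using meet \<open>opene A\<close> \<open>opene V1\<close> by blast
    obtain n where "n \<in> hitting_times T (A \<inter> (T ^^ m) -` V1) (A \<inter> (T ^^ m) -` V1)"
      "n \<in> hitting_times T (A \<inter> (T ^^ m) -` V1) ((T ^^ m) -` V2)"
      using hit[OF C vim[OF \<open>opene V2\<close>]] by blast
    then have "m + n \<in> hitting_times T A V1 \<inter> hitting_times T A V2"
      by (auto simp: hitting_times_def funpow_add)
    then show ?thesis by blast
  qed
  \<comment> \<open>The two source sets are reduced to one by taking the points of \<open>U1\<close>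
    that reach \<open>U2\<close> after \<open>m\<close> steps; since iterates commute, shifting the
    second orbit by \<open>m\<close> makes it start in \<open>U2\<close>.\<close>
  have two: "hitting_times T U1 V1 \<inter> hitting_times T U2 V2 \<noteq> {}"
    if "opene U1" "opene U2" "opene V1" "opene V2" for U1 U2 V1 V2
  proof -
    obtain m where A: "opene (U1 \<inter> (T ^^ m) -` U2)"
      using meet \<open>opene U1\<close> \<open>opene U2\<close> by blast
    obtain n where n: "n \<in> hitting_times T (U1 \<inter> (T ^^ m) -` U2) V1"
      "n \<in> hitting_times T (U1 \<inter> (T ^^ m) -` U2) ((T ^^ m) -` V2)"
      using one[OF A \<open>opene V1\<close> vim[OF \<open>opene V2\<close>]] by blast
    from n(2) obtain y where "(T ^^ m) y \<in> U2" "(T ^^ m) ((T ^^ n) y) \<in> V2"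
      by (auto simp: hitting_times_def)
    moreover have "(T ^^ m) ((T ^^ n) y) = (T ^^ n) ((T ^^ m) y)"
      using funpow_add[of m n T] funpow_add[of n m T] by (simp add: add.commute fun_eq_iff)
    ultimately have "n \<in> hitting_times T U2 V2" by (auto simp: hitting_times_def)
    then show ?thesis using n(1) by (auto simp: hitting_times_def)
  qed
  show ?thesis
    unfolding weakly_mixing_def top_transitive_def
  proof (intro allI impI)
    fix U V :: "('a \<times> 'a) set" assume UV: "opene U" "opene V"
    have box: "\<exists>X Y. opene X \<and> opene Y \<and> X \<times> Y \<subseteq> Z" if "opene Z" for Z :: "('a \<times> 'a) set"
    proof -
      obtain z where "open Z" "z \<in> Z" using \<open>opene Z\<close> by (auto simp: opene_def)
      then show ?thesis by (auto simp: opene_def elim!: open_prod_elim)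
    qed
    obtain U1 U2 where U: "opene U1" "opene U2" "U1 \<times> U2 \<subseteq> U" using box[OF UV(1)] by blast
    obtain V1 V2 where V: "opene V1" "opene V2" "V1 \<times> V2 \<subseteq> V" using box[OF UV(2)] by blast
    \<comment> \<open>Pulling both targets back by \<open>k\<close> steps forces a common hitting
      time of at least \<open>k\<close>, which gives infinitude.\<close>
    have "\<exists>n\<ge>k. n \<in> hitting_times (map_prod T T) U V" for k
    proof -
      obtain n where "n \<in> hitting_times T U1 ((T ^^ k) -` V1)" "n \<in> hitting_times T U2 ((T ^^ k) -` V2)"
        using two[OF U(1,2) vim[OF V(1)] vim[OF V(2)]] by blast
      then have "k + n \<in> hitting_times (map_prod T T) (U1 \<times> U2) (V1 \<times> V2)"
        unfolding hitting_times_map_prod by (auto simp: hitting_times_def funpow_add)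
      then have "k + n \<in> hitting_times (map_prod T T) U V"
        using U(3) V(3) unfolding hitting_times_def by blast
      then show ?thesis by (intro exI[of _ "k + n"]) simp
    qed
    then show "infinite (hitting_times (map_prod T T) U V)"
      by (simp add: infinite_nat_iff_unbounded_le)
  qed
qed

text \<open>Full support gives \<open>U\<close> positive measure, so recurrence along
  \<open>hitting_times T U V\<close> produces a time in that set at which \<open>U\<close> also
  meets its own preimage. \<open>F_Poin_recurrent\<close> makes recurrence available for a measure
  on the phase space.\<close>

lemma E_system_F_Poin_imp_weakly_mixing:
  fixes T :: "'a::topological_space \<Rightarrow> 'a"
  assumes "continuous_on UNIV T" "E_system T" "F_transitive F_Poin T"
  shows "weakly_mixing T"
proof (rule weakly_mixingI)
  show "continuous_on UNIV T" and "top_transitive T"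
    using assms by (auto simp: E_system_def)
  obtain M :: "'a measure" where M: "sets M = sets borel" "measure_preserving_system M T"
    "\<And>U. opene U \<Longrightarrow> emeasure M U > 0"
    using assms(2) by (auto simp: E_system_def)
  fix U V :: "'a set" assume UV: "opene U" "opene V"
  then have "hitting_times T U V \<in> F_Poin"
    using assms(3) by (simp add: F_transitive_def)
  then have "recurrent_along (hitting_times T U V) M T"
    using M(2) by (rule F_Poin_recurrent)
  moreover have "U \<in> sets M" using UV M(1) by (simp add: opene_def)
  ultimately obtain n where n: "n \<in> hitting_times T U V" "emeasure M (U \<inter> (T ^^ n) -` U) > 0"
    using M(3)[OF UV(1)] unfolding recurrent_along_def by blast
  then have "n \<in> hitting_times T U U"
    by (auto simp: hitting_times_def)
  with n(1) show "hitting_times T U U \<inter> hitting_times T U V \<noteq> {}" by blast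
qed

theorem theorem3p2:
  fixes T :: "'a::metric_space \<Rightarrow> 'a"
  assumes "tds T"
  shows "(weakly_mixing T \<longrightarrow> residual (Trans F_ip T)) \<and>
         (residual (Trans F_ip T) \<longrightarrow> F_point_transitive F_ip T) \<and>
         (F_point_transitive F_ip T \<longrightarrow> F_transitive F_Poin T) \<and>
         (E_system T \<longrightarrow> F_transitive F_Poin T \<longrightarrow> weakly_mixing T)"
proof (intro conjI impI)
  have comp: "compact (UNIV :: 'a set)" and cont: "continuous_on UNIV T"
    using assms by (auto simp: tds_def)
  show "residual (Trans F_ip T)" if "weakly_mixing T"
    using comp cont that by (rule weakly_mixing_imp_residual)
  \<comment> \<open>A dense set is nonempty because the phase space is a type, hence
    inhabited.\<close>
  show "F_point_transitive F_ip T" if "residual (Trans F_ip T)"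
    using that by (auto simp: residual_def F_point_transitive_def)
  show "F_transitive F_Poin T" if "F_point_transitive F_ip T"
    using that by (rule F_point_transitive_ip_imp_F_transitive_Poin)
  show "weakly_mixing T" if "E_system T" "F_transitive F_Poin T"
    using cont that by (rule E_system_F_Poin_imp_weakly_mixing)
qed

end
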